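(* Let a finite two-player zero-sum stochastic game of perfect information be given, with state space $\mathcal{S}$, action space $\mathcal{A}$, utilities in $[v_{\min}, v_{\max}]$ where $v_{\min} = -v_{\max}$, and a heuristic evaluation function $h$, and let $V_d(s)$ be the depth $d$ minimax value and $\hat{V}_d(s)$ the estimated depth $d$ minimax value with sample width $c$ (all as defined in the context). Given $c \in \mathbb{N}$ ($c \ge 1$), for any state $s \in \mathcal{S}$, for all $\lambda \in (0, 2 v_{\max}] \subset \mathbb{R}$, and for any depth $d \in \mathbb{Z}_+ = \{0,1,2,\dots\}$, \[ \mathbb{P}\left( \left| \hat{V}_d(s) - V_d(s) \right| \leq \lambda d \right) \geq 1 - \left( 2 c |\mathcal{A}| \right)^d \exp\left\{ \frac{-\lambda^2 c}{2 v_{\max}^2} \right\}. \]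
   Context: Game. $\mathcal{S}$ is a finite non-empty set of states, $\mathcal{T} \subseteq \mathcal{S}$ a non-empty set of terminal states, $\mathcal{A}$ a finite non-empty set of actions (every action is available in every state). For each $(s,a) \in \mathcal{S}\times\mathcal{A}$, $\mathcal{P}(\cdot \mid s,a)$ is a probability measure on $\mathcal{S}$. The function $u_1 : \mathcal{T} \to [v_{\min}, v_{\max}] \subseteq \mathbb{R}$ is the utility of player 1, and player 2 has utility $u_2 = -u_1$ (zero-sum); it is assumed that $v_{\min} = -v_{\max}$. The function $\tau : \mathcal{S}\setminus\mathcal{T} \to \{1,2\}$ gives the player to act. The heuristic evaluation function is $h : \mathcal{S} \to [v_{\min}, v_{\max}]$ with $h(s) = u_1(s)$ for $s \in \mathcal{T}$. Depth $d$ minimax value. For $s \in \mathcal{S}$ and $d \ge 0$, \[ V_d(s) = \begin{cases} \max_{a\in\mathcal{A}} V_d(s,a) & \text{if } d>0,\ s\notin\mathcal{T},\ \tau(s)=1,\\ \min_{a\in\mathcal{A}} V_d(s,a) & \text{if } d>0,\ s\notin\mathcal{T},\ \tau(s)=2,\\ h(s) & \text{otherwise,}\end{cases} \] where, for $d \ge 1$, $V_d(s,a) = \sum_{s'\in\mathcal{S}} \mathcal{P}(s' \mid s,a)\, V_{d-1}(s')$. Estimated depth $d$ minimax value. For a sample width $c \ge 1$, the random variable $\hat{V}_d(s)$ is defined recursively by \[ \hat{V}_d(s) = \begin{cases} \max_{a\in\mathcal{A}} \hat{V}_d(s,a) & \text{if } d>0,\ s\notin\mathcal{T},\ \tau(s)=1,\\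 \min_{a\in\mathcal{A}} \hat{V}_d(s,a) & \text{if } d>0,\ s\notin\mathcal{T},\ \tau(s)=2,\\ h(s) & \text{otherwise,}\end{cases} \] where, for $d \ge 1$, $\hat{V}_d(s,a) = \frac{1}{c}\sum_{i=1}^c \hat{V}_{d-1}(s_i)$, with $s_1,\dots,s_c$ sampled independently (with replacement) from $\mathcal{P}(\cdot \mid s,a)$. The sampling is done afresh at every (state, action) node of the depth-$d$ recursion tree, independently across nodes; thus, conditionally on $s_1,\dots,s_c$, each term $\hat{V}_{d-1}(s_i)$ is distributed as the estimated depth $d-1$ minimax value of the state $s_i$. *)

theory Defs
  imports "HOL-Probability.Probability"
begin

text \<open>
  A game is given by explicit parameters: the state and action spaces are finite types;
  \<open>P s a\<close> is the transition distribution, \<open>T\<close> the set of terminal states,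
  \<open>\<tau>\<close> the player to act (irrelevant on \<open>T\<close>), and \<open>h\<close> the heuristic evaluation function.
\<close>

datatype player = Player1 | Player2

definition best_value :: "player \<Rightarrow> ('a::finite \<Rightarrow> real) \<Rightarrow> real" where
  "best_value p q = (case p of Player1 \<Rightarrow> (MAX a. q a) | Player2 \<Rightarrow> (MIN a. q a))"

text \<open>\<open>V\<^sub>d(s,a)\<close>, where \<open>v\<close> is the function \<open>V\<^sub>d\<^sub>-\<^sub>1\<close>.\<close>

definition action_value ::
  "('s::finite \<Rightarrow> 'a \<Rightarrow> 's pmf) \<Rightarrow> ('s \<Rightarrow> real) \<Rightarrow> 's \<Rightarrow> 'a \<Rightarrow> real" where
  "action_value P v s a = (\<Sum>s'\<in>UNIV. pmf (P s a) s' * v s')"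

primrec minimax_value ::
  "('s::finite \<Rightarrow> 'a::finite \<Rightarrow> 's pmf) \<Rightarrow> 's set \<Rightarrow> ('s \<Rightarrow> player) \<Rightarrow> ('s \<Rightarrow> real)
    \<Rightarrow> nat \<Rightarrow> 's \<Rightarrow> real" where
  "minimax_value P T \<tau> h 0 = h"
| "minimax_value P T \<tau> h (Suc d) =
    (\<lambda>s. if s \<in> T then h s
         else best_value (\<tau> s) (action_value P (minimax_value P T \<tau> h d) s))"

text \<open>
  The estimated values are represented by their distributions. Given the distributions
  \<open>w s'\<close> of the depth \<open>d - 1\<close> estimates, the estimate at \<open>(s,a)\<close> draws \<open>c\<close> independent successor
  states and then, conditionally on these, independent depth \<open>d - 1\<close> estimates at each of them.
  The second argument of \<^const>\<open>Pi_pmf\<close> is only the value outside the index set.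
\<close>

definition est_action_value ::
  "nat \<Rightarrow> ('s \<Rightarrow> 'a \<Rightarrow> 's pmf) \<Rightarrow> ('s \<Rightarrow> real pmf) \<Rightarrow> 's \<Rightarrow> 'a \<Rightarrow> real pmf" where
  "est_action_value c P w s a =
    bind_pmf (Pi_pmf {1..c} undefined (\<lambda>_. P s a)) (\<lambda>\<sigma>.
      map_pmf (\<lambda>x. (1 / real c) * (\<Sum>i=1..c. x i)) (Pi_pmf {1..c} 0 (\<lambda>i. w (\<sigma> i))))"

text \<open>The estimates for the different actions at a state are independent of each other.\<close>

primrec est_minimax_value ::
  "nat \<Rightarrow> ('s \<Rightarrow> 'a::finite \<Rightarrow> 's pmf) \<Rightarrow> 's set \<Rightarrow> ('s \<Rightarrow> player) \<Rightarrow> ('s \<Rightarrow> real)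
    \<Rightarrow> nat \<Rightarrow> 's \<Rightarrow> real pmf" where
  "est_minimax_value c P T \<tau> h 0 = (\<lambda>s. return_pmf (h s))"
| "est_minimax_value c P T \<tau> h (Suc d) =
    (\<lambda>s. if s \<in> T then return_pmf (h s)
         else map_pmf (best_value (\<tau> s))
           (Pi_pmf UNIV 0 (est_action_value c P (est_minimax_value c P T \<tau> h d) s)))"

end

theory Submission
  imports Defs
begin

text \<open>
  Compare the estimate at \<open>(s,a)\<close> first with the average of the exact depth \<open>d\<close> values at the
  sampled successors, then that average with its mean \<open>V\<^sub>d\<^sub>+\<^sub>1(s,a)\<close>. Hoeffding's inequality
  bounds the probability that the second error exceeds \<open>\<lambda>\<close> by \<open>2 E\<close>, with
  \<open>E = exp (- \<lambda>\<^sup>2 c / (2 v\<^sub>m\<^sub>a\<^sub>x\<^sup>2))\<close>, and a union bound over the \<open>c\<close> samples controls the first.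
  As max and min are nonexpansive, the failure probabilities satisfy \<open>p\<^sub>0 = 0\<close> and
  \<open>p\<^sub>d\<^sub>+\<^sub>1 \<le> |A| (2 E + c p\<^sub>d)\<close>; since \<open>p\<^sub>0 = 0\<close>, the term \<open>2 E\<close> is absorbed into
  \<open>(2 c |A|)\<^sup>d E\<close> at every depth.
\<close>

section \<open>Probability bounds for products and mixtures\<close>

lemma prob_Pi_pmf_Bex_le:
  assumes "finite I"
  shows "measure_pmf.prob (Pi_pmf I dflt p) {x. \<exists>i\<in>I. x i \<in> B i}
    \<le> (\<Sum>i\<in>I. measure_pmf.prob (p i) (B i))"
proof -
  have "{x. \<exists>i\<in>I. x i \<in> B i} = (\<Union>i\<in>I. (\<lambda>x. x i) -` B i)"
    by auto
  then have "measure_pmf.prob (Pi_pmf I dflt p) {x. \<exists>i\<in>I. x i \<in> B i}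
      \<le> (\<Sum>i\<in>I. measure_pmf.prob (Pi_pmf I dflt p) ((\<lambda>x. x i) -` B i))"
    using assms by (auto intro: measure_pmf.finite_measure_subadditive_finite)
  also have "\<dots> = (\<Sum>i\<in>I. measure_pmf.prob (p i) (B i))"
  proof (intro sum.cong refl)
    fix i assume "i \<in> I"
    then have "p i = map_pmf (\<lambda>x. x i) (Pi_pmf I dflt p)"
      using assms by (simp add: Pi_pmf_component)
    then show "measure_pmf.prob (Pi_pmf I dflt p) ((\<lambda>x. x i) -` B i) = measure_pmf.prob (p i) (B i)"
      by simp
  qed
  finally show ?thesis .
qed

text \<open>Condition on the first draw: on the bad set \<open>B\<close> the conditional probability
  is at most 1, off \<open>B\<close> at most \<open>e\<close>. Integrating
  \<open>indicator B x + e\<close> gives the bound.\<close>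

lemma prob_bind_pmf_le:
  fixes p :: "'a pmf" and f :: "'a \<Rightarrow> 'b pmf"
  assumes "0 \<le> e" and "\<And>x. x \<notin> B \<Longrightarrow> measure_pmf.prob (f x) A \<le> e"
  shows "measure_pmf.prob (bind_pmf p f) A \<le> measure_pmf.prob p B + e"
proof -
  have "ennreal (measure_pmf.prob (bind_pmf p f) A) = (\<integral>\<^sup>+x. emeasure (f x) A \<partial>p)"
    by (simp flip: measure_pmf.emeasure_eq_measure)
  also have "\<dots> \<le> (\<integral>\<^sup>+x. indicator B x + ennreal e \<partial>p)"
  proof (intro nn_integral_mono)
    fix x
    show "emeasure (f x) A \<le> indicator B x + ennreal e"
      using assms by (cases "x \<in> B")
        (auto simp: measure_pmf.emeasure_eq_measure intro: order_trans[OF _ add_increasing2])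
  qed
  also have "\<dots> = ennreal (measure_pmf.prob p B + e)"
    using assms(1) by (simp add: nn_integral_add measure_pmf.emeasure_eq_measure)
  finally show ?thesis
    using assms(1) by (subst (asm) ennreal_le_iff) simp_all
qed

text \<open>Under a product with constant factor \<open>p\<close>, the coordinates are independent
  copies of \<open>p\<close>, so Hoeffding's inequality for i.i.d. bounded variables applies to the
  \<open>v (\<sigma> i)\<close>.\<close>

lemma Hoeffding_Pi_pmf:
  fixes v :: "'a \<Rightarrow> real"
  assumes I: "finite I" "I \<noteq> {}" and v: "\<And>x. v x \<in> {a..b}" and "a < b" and "0 \<le> \<epsilon>"
  shows "measure_pmf.prob (Pi_pmf I dflt (\<lambda>_. p))
      {\<sigma>. \<bar>(\<Sum>i\<in>I. v (\<sigma> i)) / real (card I) - measure_pmf.expectation p v\<bar> \<ge> \<epsilon>}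
    \<le> 2 * exp (- 2 * real (card I) * \<epsilon>\<^sup>2 / (b - a)\<^sup>2)"
proof -
  \<comment> \<open>The i.i.d. locale wants a reference variable with the common distribution;
    coordinate \<open>i0\<close> provides it.\<close>
  obtain i0 where "i0 \<in> I"
    using I by auto
  let ?M = "Pi_pmf I dflt (\<lambda>_. p)"
  have distr: "distr ?M borel (\<lambda>\<sigma>. v (\<sigma> i)) = distr (measure_pmf p) borel v" if "i \<in> I" for i
  proof -
    have "distr ?M borel (\<lambda>\<sigma>. v (\<sigma> i)) = distr (measure_pmf (map_pmf (\<lambda>\<sigma>. \<sigma> i) ?M)) borel v"
      unfolding map_pmf_rep_eq by (subst distr_distr) (auto simp: o_def)
    then show ?thesis
      using that I by (simp add: Pi_pmf_component)
  qed
  have exp: "measure_pmf.expectation p v = measure_pmf.expectation ?M (\<lambda>\<sigma>. v (\<sigma> i0))"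
  proof -
    have "p = map_pmf (\<lambda>\<sigma>. \<sigma> i0) ?M"
      using I \<open>i0 \<in> I\<close> by (simp add: Pi_pmf_component)
    then show ?thesis
      by (metis integral_map_pmf)
  qed
  interpret Hoeffding_ineq_iid ?M I "\<lambda>i \<sigma>. v (\<sigma> i)" "\<lambda>\<sigma>. v (\<sigma> i0)" a b
    "measure_pmf.expectation p v"
  proof unfold_locales
    show "prob_space.indep_vars ?M (\<lambda>_. borel) (\<lambda>i \<sigma>. v (\<sigma> i)) I"
      using I by (intro prob_space.indep_vars_compose2[OF _ indep_vars_Pi_pmf])
        (auto simp: measure_pmf.prob_space_axioms)
  qed (use I v distr \<open>i0 \<in> I\<close> exp in auto)
  show ?thesis
    using Hoeffding_ineq_abs_ge' assms by simp
qed

section \<open>Stability and range of max and min\<close>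

lemma Max_image_diff_le:
  fixes f g :: "'a::finite \<Rightarrow> real"
  assumes "\<And>a. f a \<le> g a + e"
  shows "(MAX a. f a) \<le> (MAX a. g a) + e"
proof -
  have "f a \<le> (MAX a. g a) + e" for a
    by (rule order_trans[OF assms]) simp
  then show ?thesis
    by simp
qed

lemma Min_image_diff_le:
  fixes f g :: "'a::finite \<Rightarrow> real"
  assumes "\<And>a. f a \<le> g a + e"
  shows "(MIN a. f a) \<le> (MIN a. g a) + e"
proof -
  have "(MIN a. f a) - e \<le> g a" for a
  proof -
    have "(MIN a. f a) \<le> f a"
      by simp
    with assms[of a] show ?thesis
      by linarith
  qed
  then have "(MIN a. f a) - e \<le> (MIN a. g a)"
    by simp
  then show ?thesis
    by linarith
qed

text \<open>Max and min are monotone and commute with adding a constant; apply this to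
  \<open>f \<le> g + e\<close> and \<open>g \<le> f + e\<close>.\<close>

lemma best_value_nonexpansive:
  assumes "\<And>a. \<bar>f a - g a\<bar> \<le> e"
  shows "\<bar>best_value p f - best_value p g\<bar> \<le> e"
proof -
  have "f a \<le> g a + e" "g a \<le> f a + e" for a
    using assms[of a] by linarith+
  then have "(MAX a. f a) \<le> (MAX a. g a) + e" "(MAX a. g a) \<le> (MAX a. f a) + e"
    "(MIN a. f a) \<le> (MIN a. g a) + e" "(MIN a. g a) \<le> (MIN a. f a) + e"
    by (intro Max_image_diff_le Min_image_diff_le; simp)+
  then show ?thesis
    unfolding best_value_def by (cases p) (simp_all only: player.case abs_le_iff, linarith+)
qed

lemma best_value_in_interval:
  assumes "\<And>a. f a \<in> {l..u}"
  shows "best_value p f \<in> {l..u}"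
proof -
  \<comment> \<open>Extrema over a finite nonempty range are attained, so the best value is one of
    the \<open>f a\<close>.\<close>
  have "Max (range f) \<in> range f" "Min (range f) \<in> range f"
    by (simp_all only: Max_in Min_in finite finite_imageI image_is_empty UNIV_not_empty not_False_eq_True)
  then have "best_value p f \<in> range f"
    unfolding best_value_def by (cases p) simp_all
  then show ?thesis
    using assms by (metis imageE)
qed

section \<open>Exact values and the error at one action\<close>

lemma action_value_eq_expectation:
  "action_value P v s a = measure_pmf.expectation (P s a) v"
  unfolding action_value_def by (subst integral_measure_pmf[of UNIV]) auto

lemma action_value_in_interval:
  assumes "\<And>s. v s \<in> {l..u}"
  shows "action_value P v s a \<in> {l..u}"
  unfolding action_value_eq_expectation using assms
  by (auto intro!: measure_pmf.integral_ge_const measure_pmf.integral_le_const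
      integrable_measure_pmf_finite)

text \<open>Averages and extrema stay inside an interval; this supplies the bounded summands for
  Hoeffding's inequality.\<close>

lemma minimax_value_in_interval:
  assumes "\<And>s. h s \<in> {l..u}"
  shows "minimax_value P T \<tau> h d s \<in> {l..u}"
proof (induction d arbitrary: s)
  case 0
  then show ?case
    using assms by simp
next
  case (Suc d)
  have "best_value (\<tau> s) (action_value P (minimax_value P T \<tau> h d) s) \<in> {l..u}"
    by (intro best_value_in_interval action_value_in_interval Suc.IH)
  then show ?case
    using assms by simp
qed

lemma est_action_value_error:
  fixes P :: "'s::finite \<Rightarrow> 'a \<Rightarrow> 's pmf"
  assumes c: "c \<ge> 1" and v: "\<And>s. v s \<in> {l..u}" and "l < u" and "0 \<le> \<epsilon>"
    and w: "\<And>s. measure_pmf.prob (w s) {x. \<bar>x - v s\<bar> > \<delta>} \<le> q"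
  shows "measure_pmf.prob (est_action_value c P w s a) {x. \<bar>x - action_value P v s a\<bar> > \<epsilon> + \<delta>}
    \<le> 2 * exp (- 2 * real c * \<epsilon>\<^sup>2 / (u - l)\<^sup>2) + real c * q"
proof -
  let ?m = "action_value P v s a"
  \<comment> \<open>Bad successor draws: the exact values at the sampled states average too far from
    their mean.\<close>
  let ?B = "{\<sigma>. \<bar>(\<Sum>i=1..c. v (\<sigma> i)) / real c - ?m\<bar> \<ge> \<epsilon>}"
  let ?g = "\<lambda>x. 1 / real c * (\<Sum>i=1..c. x i)"
  have "0 \<le> q"
    using w measure_nonneg order_trans by blast
  have "measure_pmf.prob (est_action_value c P w s a) {x. \<bar>x - ?m\<bar> > \<epsilon> + \<delta>}
      \<le> measure_pmf.prob (Pi_pmf {1..c} undefined (\<lambda>_. P s a)) ?B + real c * q"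
    unfolding est_action_value_def
  proof (rule prob_bind_pmf_le)
    fix \<sigma> assume "\<sigma> \<notin> ?B"
    then have \<sigma>: "\<bar>(\<Sum>i=1..c. v (\<sigma> i)) / real c - ?m\<bar> < \<epsilon>"
      by simp
    \<comment> \<open>Contrapositive: if all \<open>c\<close> sub-estimates are within
      \<open>\<delta>\<close>, so is their average, and the triangle inequality with
      \<open>\<sigma>\<close> keeps the total error below
      \<open>\<epsilon> + \<delta>\<close>.\<close>
    have sub: "?g -` {x. \<bar>x - ?m\<bar> > \<epsilon> + \<delta>} \<subseteq> {x. \<exists>i\<in>{1..c}. x i \<in> {y. \<bar>y - v (\<sigma> i)\<bar> > \<delta>}}"
    proof (rule subsetI, rule ccontr)
      fix x assume x: "x \<in> ?g -` {x. \<bar>x - ?m\<bar> > \<epsilon> + \<delta>}"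
        and "x \<notin> {x. \<exists>i\<in>{1..c}. x i \<in> {y. \<bar>y - v (\<sigma> i)\<bar> > \<delta>}}"
      then have "\<bar>x i - v (\<sigma> i)\<bar> \<le> \<delta>" if "i \<in> {1..c}" for i
        using that by (auto simp: not_less)
      then have "(\<Sum>i=1..c. \<bar>x i - v (\<sigma> i)\<bar>) \<le> real c * \<delta>"
        using sum_bounded_above[of "{1..c}" "\<lambda>i. \<bar>x i - v (\<sigma> i)\<bar>" \<delta>] by simp
      then have "\<bar>(\<Sum>i=1..c. x i) - (\<Sum>i=1..c. v (\<sigma> i))\<bar> \<le> real c * \<delta>"
        unfolding sum_subtractf[symmetric] by (rule order_trans[OF sum_abs])
      then have "\<bar>(\<Sum>i=1..c. x i) - (\<Sum>i=1..c. v (\<sigma> i))\<bar> / real c \<le> \<delta>"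
        using c by (simp add: field_simps)
      then have "\<bar>?g x - (\<Sum>i=1..c. v (\<sigma> i)) / real c\<bar> \<le> \<delta>"
        by (simp add: abs_divide flip: diff_divide_distrib)
      with \<sigma> x show False
        by simp
    qed
    have "measure_pmf.prob (map_pmf ?g (Pi_pmf {1..c} 0 (\<lambda>i. w (\<sigma> i)))) {x. \<bar>x - ?m\<bar> > \<epsilon> + \<delta>}
        \<le> measure_pmf.prob (Pi_pmf {1..c} 0 (\<lambda>i. w (\<sigma> i)))
            {x. \<exists>i\<in>{1..c}. x i \<in> {y. \<bar>y - v (\<sigma> i)\<bar> > \<delta>}}"
      unfolding measure_map_pmf using sub by (intro measure_pmf.finite_measure_mono) auto
    also have "\<dots> \<le> (\<Sum>i=1..c. measure_pmf.prob (w (\<sigma> i)) {y. \<bar>y - v (\<sigma> i)\<bar> > \<delta>})"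
      by (intro prob_Pi_pmf_Bex_le) simp
    also have "\<dots> \<le> real c * q"
      using sum_bounded_above[of "{1..c}" _ q] w by simp
    finally show "measure_pmf.prob (map_pmf ?g (Pi_pmf {1..c} 0 (\<lambda>i. w (\<sigma> i))))
        {x. \<bar>x - ?m\<bar> > \<epsilon> + \<delta>} \<le> real c * q" .
  qed (use \<open>0 \<le> q\<close> in simp)
  moreover have "measure_pmf.prob (Pi_pmf {1..c} undefined (\<lambda>_. P s a)) ?B
      \<le> 2 * exp (- 2 * real c * \<epsilon>\<^sup>2 / (u - l)\<^sup>2)"
    using Hoeffding_Pi_pmf[of "{1..c}" v l u \<epsilon> undefined "P s a"] assms
    by (simp add: action_value_eq_expectation)
  ultimately show ?thesis
    by simp
qed

section \<open>From one action to a state, and induction on depth\<close>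

lemma prob_best_value_error_le:
  fixes f :: "'a::finite \<Rightarrow> real"
  assumes "\<And>a. measure_pmf.prob (w a) {x. \<bar>x - f a\<bar> > \<delta>} \<le> q"
  shows "measure_pmf.prob (map_pmf (best_value p) (Pi_pmf UNIV dflt w))
      {x. \<bar>x - best_value p f\<bar> > \<delta>} \<le> real CARD('a) * q"
proof -
  \<comment> \<open>By nonexpansiveness, an error above \<open>\<delta>\<close> at the state forces
    one at some action.\<close>
  have "best_value p -` {x. \<bar>x - best_value p f\<bar> > \<delta>} \<subseteq> {x. \<exists>a\<in>UNIV. x a \<in> {y. \<bar>y - f a\<bar> > \<delta>}}"
    using best_value_nonexpansive[of _ f \<delta> p] by (force simp: not_less[symmetric])
  then have "measure_pmf.prob (map_pmf (best_value p) (Pi_pmf UNIV dflt w))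
      {x. \<bar>x - best_value p f\<bar> > \<delta>}
      \<le> measure_pmf.prob (Pi_pmf UNIV dflt w) {x. \<exists>a\<in>UNIV. x a \<in> {y. \<bar>y - f a\<bar> > \<delta>}}"
    unfolding measure_map_pmf by (intro measure_pmf.finite_measure_mono) auto
  also have "\<dots> \<le> (\<Sum>a\<in>UNIV. measure_pmf.prob (w a) {y. \<bar>y - f a\<bar> > \<delta>})"
    by (rule prob_Pi_pmf_Bex_le) simp
  also have "\<dots> \<le> real CARD('a) * q"
    by (rule sum_bounded_above) (rule assms)
  finally show ?thesis .
qed

text \<open>The bound 0 at depth 0, where the estimate is exact, is what lets the induction close:
  starting from \<open>E\<close> would give \<open>CARD('a) * (2 + c) * E\<close> at depth 1, which
  exceeds \<open>2 * c * CARD('a) * E\<close> when \<open>c = 1\<close>.\<close>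

lemma est_minimax_value_error:
  fixes P :: "'s::finite \<Rightarrow> 'a::finite \<Rightarrow> 's pmf"
  assumes h: "\<And>s. h s \<in> {l..u}" and c: "c \<ge> 1" and "l < u" and "0 \<le> \<epsilon>"
  defines "E \<equiv> exp (- 2 * real c * \<epsilon>\<^sup>2 / (u - l)\<^sup>2)"
  shows "measure_pmf.prob (est_minimax_value c P T \<tau> h d s)
      {x. \<bar>x - minimax_value P T \<tau> h d s\<bar> > \<epsilon> * real d}
    \<le> (if d = 0 then 0 else (2 * real c * real CARD('a)) ^ d * E)"
proof (induction d arbitrary: s)
  case 0
  then show ?case
    by simp
next
  case (Suc d)
  let ?q = "if d = 0 then 0 else (2 * real c * real CARD('a)) ^ d * E"
  let ?r = "(2 * real c * real CARD('a)) ^ Suc d * E"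
  have "0 \<le> ?r"
    by (simp add: E_def)
  show ?case
  proof (cases "s \<in> T")
    case True
    then show ?thesis
      using \<open>0 \<le> ?r\<close> \<open>0 \<le> \<epsilon>\<close> by (simp add: not_less)
  next
    case False
    \<comment> \<open>Each level adds one \<open>\<epsilon>\<close> to the tolerance: here
      \<open>\<delta>\<close> is \<open>\<epsilon> * d\<close>.\<close>
    have "measure_pmf.prob (est_action_value c P (est_minimax_value c P T \<tau> h d) s a)
        {x. \<bar>x - action_value P (minimax_value P T \<tau> h d) s a\<bar> > \<epsilon> + \<epsilon> * real d}
        \<le> 2 * E + real c * ?q" for a
      unfolding E_def
      by (rule est_action_value_error[OF c minimax_value_in_interval[OF h] \<open>l < u\<close> \<open>0 \<le> \<epsilon>\<close>
            Suc.IH[unfolded E_def]])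
    from prob_best_value_error_le[OF this]
    have "measure_pmf.prob (est_minimax_value c P T \<tau> h (Suc d) s)
        {x. \<bar>x - minimax_value P T \<tau> h (Suc d) s\<bar> > \<epsilon> * real (Suc d)}
        \<le> real CARD('a) * (2 * E + real c * ?q)"
      using False
      by (simp only: est_minimax_value.simps minimax_value.simps if_False of_nat_Suc
          distrib_left mult_1_right)
    also have "\<dots> \<le> ?r"
    proof -
      \<comment> \<open>With \<open>K = 2 * c * CARD('a)\<close>, the right side is twice
        \<open>c * K ^ d * E\<close>. For \<open>d > 0\<close> one copy is \<open>c * ?q\<close>;
        the other absorbs \<open>2 * E\<close> because \<open>K \<ge> 2\<close>. For
        \<open>d = 0\<close> only \<open>c \<ge> 1\<close> is used.\<close>
      have "2 * E + real c * ?q \<le> 2 * real c * (2 * real c * real CARD('a)) ^ d * E"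
      proof (cases "d = 0")
        case True
        then show ?thesis
          using c by (simp add: E_def)
      next
        case False
        have A: "1 \<le> real CARD('a)"
          by (simp add: Suc_leI)
        with c have "2 * 1 \<le> 2 * (real c * real CARD('a))"
          using mult_mono[of 1 "real c" 1 "real CARD('a)"] by simp
        then have "2 \<le> (2 * real c * real CARD('a)) ^ d"
          using False self_le_power[of "2 * real c * real CARD('a)" d] by simp
        then have "1 * 2 \<le> real c * (2 * real c * real CARD('a)) ^ d"
          using c by (intro mult_mono) auto
        then have "2 * E \<le> real c * (2 * real c * real CARD('a)) ^ d * E"
          by (intro mult_right_mono) (auto simp: E_def)
        then show ?thesis
          using False by (simp add: ac_simps)
      qed
      then have "real CARD('a) * (2 * E + real c * ?q)
          \<le> real CARD('a) * (2 * real c * (2 * real c * real CARD('a)) ^ d * E)"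
        by (intro mult_left_mono) auto
      then show ?thesis
        by (simp add: ac_simps)
    qed
    finally show ?thesis
      by simp
  qed
qed

theorem theorem1:
  fixes P :: "'s::finite \<Rightarrow> 'a::finite \<Rightarrow> 's pmf"
    and T :: "'s set"
    and u1 u2 h :: "'s \<Rightarrow> real"
    and v_min v_max lam :: real
    and \<tau> :: "'s \<Rightarrow> player"
    and c d :: nat
    and s :: 's
  assumes "T \<noteq> {}"
    and "\<forall>t\<in>T. u1 t \<in> {v_min..v_max}"
    and "\<forall>t\<in>T. u2 t = - u1 t"
    and "v_min = - v_max"
    and "\<forall>s. h s \<in> {v_min..v_max}"
    and "\<forall>t\<in>T. h t = u1 t"
    and "c \<ge> 1"
    and "lam \<in> {0<..2 * v_max}"
  shows "measure_pmf.prob (est_minimax_value c P T \<tau> h d s)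
           {x. \<bar>x - minimax_value P T \<tau> h d s\<bar> \<le> lam * real d}
         \<ge> 1 - (2 * real c * real CARD('a)) ^ d * exp (- (lam\<^sup>2) * real c / (2 * v_max\<^sup>2))"
proof -
  let ?M = "est_minimax_value c P T \<tau> h d s"
  let ?good = "{x. \<bar>x - minimax_value P T \<tau> h d s\<bar> \<le> lam * real d}"
  let ?E = "exp (- (lam\<^sup>2) * real c / (2 * v_max\<^sup>2))"
  have "0 < lam" "0 < v_max"
    using assms(8) by auto
  \<comment> \<open>The interval has width \<open>2 * v_max\<close>, whose square
    \<open>4 * v_max\<^sup>2\<close> turns the factor 2 in Hoeffding's exponent into 1/2.\<close>
  then have E: "exp (- 2 * real c * lam\<^sup>2 / (v_max - - v_max)\<^sup>2) = ?E"
    by (simp add: power2_eq_square field_simps)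
  have "measure_pmf.prob ?M (- ?good)
      \<le> (if d = 0 then 0 else (2 * real c * real CARD('a)) ^ d * ?E)"
    using est_minimax_value_error[of h "- v_max" v_max c lam P T \<tau> d s, unfolded E]
      assms(4,5,7) \<open>0 < lam\<close> \<open>0 < v_max\<close> by (simp add: Collect_neg_eq[symmetric] not_le)
  \<comment> \<open>At depth 0 this weakens 0 to the positive \<open>?E\<close>; otherwise it is an
    equality.\<close>
  also have "\<dots> \<le> (2 * real c * real CARD('a)) ^ d * ?E"
    by simp
  finally have "measure_pmf.prob ?M (- ?good) \<le> (2 * real c * real CARD('a)) ^ d * ?E" .
  moreover have "measure_pmf.prob ?M (- ?good) = 1 - measure_pmf.prob ?M ?good"
    using measure_pmf.prob_compl[of ?good ?M] by (simp add: Compl_eq_Diff_UNIV)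
  ultimately show ?thesis
    by simp
qed

end
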